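(* Let $\Delta t_m>0$, let $\vec X^m\in \underline V^h_{\partial_0}$, and let $(\vec X^{m+1},\varkappa^{m+1})$, with $\vec X^{m+1}-\vec X^m\in\underline V^h_{\partial}$ and $\varkappa^{m+1}\in V^h$, be a solution of the fully discrete scheme $$\frac{1}{\Delta t_m}\bigl\langle \vec X^{m+1}-\vec X^m,\ \chi\,\vec f^{\,m+\frac12}\bigr\rangle-\bigl\langle (\vec X^m\cdot\vec e_1)\,\varkappa^{m+1}_\rho,\ \chi_\rho\,|\vec X^m_\rho|^{-1}\bigr\rangle=0\qquad\forall\,\chi\in V^h,$$ $$\bigl\langle \varkappa^{m+1}\,\vec f^{\,m+\frac12},\ \vec\eta\bigr\rangle+\bigl\langle \vec\eta\cdot\vec e_1,\ |\vec X^{m+1}_\rho|\bigr\rangle+\bigl\langle (\vec X^m\cdot\vec e_1)\,\vec X^{m+1}_\rho,\ \vec\eta_\rho\,|\vec X^m_\rho|^{-1}\bigr\rangle=0\qquad\forall\,\vec\eta\in\underline V^h_{\partial}.$$ Then $$A(\vec X^{m+1})+2\pi\,\Delta t_m\bigl\langle (\vec X^m\cdot\vec e_1)\,\varkappa^{m+1}_\rho,\ \varkappa^{m+1}_\rho\,|\vec X^m_\rho|^{-1}\bigr\rangle\le A(\vec X^m).$$ Moreover, $M(\vec X^{m+1})=M(\vec X^m)$.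
   Context: Domain and boundary. Either $\mathbb I=\mathbb R/\mathbb Z$ (with $\partial\mathbb I=\emptyset$) or $\mathbb I=(0,1)$ (with $\partial\mathbb I=\{0,1\}$). $\partial\mathbb I=\partial_D\mathbb I\cup\partial_0\mathbb I\cup\partial_1\mathbb I\cup\partial_2\mathbb I$ is a given disjoint partition. $\vec e_1,\vec e_2$ is the standard basis of $\mathbb R^2$; $\langle\cdot,\cdot\rangle$ is the $L^2$ inner product over $\mathbb I$ (scalar or vector valued); subscript $\rho$ is the derivative on $\mathbb I$ (piecewise for finite element functions); $(a,b)^\perp=(b,-a)$ is clockwise rotation by $\pi/2$. Finite element spaces. For an integer $J\ge3$, $h=1/J$, $q_j=jh$, $\mathbb I_j=[q_{j-1},q_j]$. $V^h$ is the space of continuous functions on $\overline{\mathbb I}$ that are affine on each $\mathbb I_j$ (periodic if $\mathbb I=\mathbb R/\mathbb Z$). $\underline V^h_{\partial_0}=\{\vec\eta\in[V^h]^2:\vec\eta(\rho)\cdot\vec e_1=0\ \forall\rho\in\partial_0\mathbb I\}$, and $\underline V^h_{\partial}=\{\vec\eta\in\underline V^h_{\partial_0}:\vec\eta(\rho)\cdot\vec e_i=0\ \forall\rho\in\partial_i\mathbb I,\ i=1,2;\ \vec\eta(\rho)=\vec 0\ \forall\rho\in\partial_D\mathbb I\}$. Standing assumptions. For $\vec X\in\{\vec X^m,\vec X^{m+1}\}$: $\vec X\cdot\vec e_1>0$ in $\overline{\mathbb I}\setminus\partial_0\mathbb I$ and $|\vec X_\rho|>0$ in $\mathbb I$ (on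 each element). $\vec X$ parameterizes the generating curve of a surface rotationally symmetric about the $x_2$-axis. Time-averaged weighted normal: $$\vec f^{\,m+\frac12}=-\tfrac16\Bigl(2(\vec X^m\cdot\vec e_1)\vec X^m_\rho+2(\vec X^{m+1}\cdot\vec e_1)\vec X^{m+1}_\rho+(\vec X^m\cdot\vec e_1)\vec X^{m+1}_\rho+(\vec X^{m+1}\cdot\vec e_1)\vec X^m_\rho\Bigr)^\perp .$$ Surface area: $A(\vec X)=2\pi\int_{\mathbb I}(\vec X\cdot\vec e_1)\,|\vec X_\rho|\,d\rho$. Enclosed volume (up to an additive constant): $M(\vec X)=\pi\langle(\vec X\cdot\vec e_1)^2\,\vec\nu,\ \vec e_1\,|\vec X_\rho|\rangle+\pi\sum_{p\in\partial_1\mathbb I}(-1)^{p+1}(\vec X(p)\cdot\vec e_1)^2\,\vec X(p)\cdot\vec e_2$, where $\vec\nu=-|\vec X_\rho|^{-1}(\vec X_\rho)^\perp$ is the unit normal (the parameterization being oriented so that $\vec\nu$ is the outer normal). *)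

theory Defs
  imports "HOL-Analysis.Analysis"
begin

text \<open>
  Both domains are represented by the fundamental interval \<open>{0..1}\<close>. A function on
  \<open>\<real>/\<int>\<close> is a 1-periodic function on \<open>\<real>\<close>; for a function on \<open>[0,1]\<close> the
  values outside \<open>{0..1}\<close> are irrelevant.
\<close>

datatype param_domain = Circle | Unit_Interval

fun domain_boundary :: "param_domain \<Rightarrow> real set" where
  "domain_boundary Circle = {}"
| "domain_boundary Unit_Interval = {0, 1}"

definition boundary_partition ::
  "param_domain \<Rightarrow> real set \<Rightarrow> real set \<Rightarrow> real set \<Rightarrow> real set \<Rightarrow> bool" where
  "boundary_partition I BD B0 B1 B2 \<longleftrightarrow>
     domain_boundary I = BD \<union> B0 \<union> B1 \<union> B2 \<and>
     BD \<inter> B0 = {} \<and> BD \<inter> B1 = {} \<and> BD \<inter> B2 = {} \<and>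
     B0 \<inter> B1 = {} \<and> B0 \<inter> B2 = {} \<and> B1 \<inter> B2 = {}"

abbreviation e1 :: "real ^ 2" where "e1 \<equiv> axis 1 1"
abbreviation e2 :: "real ^ 2" where "e2 \<equiv> axis 2 1"

definition perp :: "real ^ 2 \<Rightarrow> real ^ 2" where
  "perp v = vector [v $ 2, - (v $ 1)]"

text \<open>
  For functions that are affine on each element this is the piecewise derivative in the
  interior of every element; its (unspecified) values at the finitely many nodes do not
  affect any integral.
\<close>

abbreviation d\<rho> :: "(real \<Rightarrow> 'a::real_normed_vector) \<Rightarrow> real \<Rightarrow> 'a" where
  "d\<rho> f \<rho> \<equiv> vector_derivative f (at \<rho>)"

definition l2_inner :: "(real \<Rightarrow> 'a::real_inner) \<Rightarrow> (real \<Rightarrow> 'a) \<Rightarrow> real" where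
  "l2_inner u v = integral {0..1} (\<lambda>\<rho>. u \<rho> \<bullet> v \<rho>)"

definition node :: "nat \<Rightarrow> nat \<Rightarrow> real" where
  "node J j = real j * (1 / real J)"

definition element :: "nat \<Rightarrow> nat \<Rightarrow> real set" where
  "element J j = {node J (j - 1) .. node J j}"

definition Vh :: "param_domain \<Rightarrow> nat \<Rightarrow> (real \<Rightarrow> real) set" where
  "Vh I J = {\<phi>. continuous_on {0..1} \<phi> \<and>
     (\<forall>j\<in>{1..J}. \<exists>a b. \<forall>\<rho>\<in>element J j. \<phi> \<rho> = a + b * \<rho>) \<and>
     (I = Circle \<longrightarrow> (\<forall>\<rho>. \<phi> (\<rho> + 1) = \<phi> \<rho>))}"

definition Vh_vec :: "param_domain \<Rightarrow> nat \<Rightarrow> (real \<Rightarrow> real ^ 2) set" where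
  "Vh_vec I J = {\<eta>. \<forall>i. (\<lambda>\<rho>. \<eta> \<rho> $ i) \<in> Vh I J}"

definition Vh_d0 :: "param_domain \<Rightarrow> nat \<Rightarrow> real set \<Rightarrow> (real \<Rightarrow> real ^ 2) set" where
  "Vh_d0 I J B0 = {\<eta> \<in> Vh_vec I J. \<forall>\<rho>\<in>B0. \<eta> \<rho> \<bullet> e1 = 0}"

definition Vh_d ::
  "param_domain \<Rightarrow> nat \<Rightarrow> real set \<Rightarrow> real set \<Rightarrow> real set \<Rightarrow> real set \<Rightarrow> (real \<Rightarrow> real ^ 2) set" where
  "Vh_d I J BD B0 B1 B2 = {\<eta> \<in> Vh_d0 I J B0.
     (\<forall>\<rho>\<in>B1. \<eta> \<rho> \<bullet> e1 = 0) \<and> (\<forall>\<rho>\<in>B2. \<eta> \<rho> \<bullet> e2 = 0) \<and> (\<forall>\<rho>\<in>BD. \<eta> \<rho> = 0)}"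

definition admissible_curve :: "nat \<Rightarrow> real set \<Rightarrow> (real \<Rightarrow> real ^ 2) \<Rightarrow> bool" where
  "admissible_curve J B0 X \<longleftrightarrow>
     (\<forall>\<rho>\<in>{0..1} - B0. X \<rho> \<bullet> e1 > 0) \<and>
     (\<forall>j\<in>{1..J}. \<forall>\<rho>\<in>interior (element J j). norm (d\<rho> X \<rho>) > 0)"

definition avg_weighted_normal :: "(real \<Rightarrow> real ^ 2) \<Rightarrow> (real \<Rightarrow> real ^ 2) \<Rightarrow> real \<Rightarrow> real ^ 2" where
  "avg_weighted_normal X Y \<rho> = - ((1 / 6) *\<^sub>R perp (
      (2 * (X \<rho> \<bullet> e1)) *\<^sub>R d\<rho> X \<rho> + (2 * (Y \<rho> \<bullet> e1)) *\<^sub>R d\<rho> Y \<rho>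
      + (X \<rho> \<bullet> e1) *\<^sub>R d\<rho> Y \<rho> + (Y \<rho> \<bullet> e1) *\<^sub>R d\<rho> X \<rho>))"

definition surface_area :: "(real \<Rightarrow> real ^ 2) \<Rightarrow> real" where
  "surface_area X = 2 * pi * integral {0..1} (\<lambda>\<rho>. (X \<rho> \<bullet> e1) * norm (d\<rho> X \<rho>))"

definition unit_normal :: "(real \<Rightarrow> real ^ 2) \<Rightarrow> real \<Rightarrow> real ^ 2" where
  "unit_normal X \<rho> = - (inverse (norm (d\<rho> X \<rho>)) *\<^sub>R perp (d\<rho> X \<rho>))"

text \<open>
  The boundary points \<open>p \<in> {0, 1}\<close> are reals, hence the floor in the exponent of \<open>(-1)^{p+1}\<close>.
\<close>

definition enclosed_volume :: "real set \<Rightarrow> (real \<Rightarrow> real ^ 2) \<Rightarrow> real" where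
  "enclosed_volume B1 X =
     pi * l2_inner (\<lambda>\<rho>. (X \<rho> \<bullet> e1)\<^sup>2 *\<^sub>R unit_normal X \<rho>) (\<lambda>\<rho>. norm (d\<rho> X \<rho>) *\<^sub>R e1)
     + pi * (\<Sum>p\<in>B1. (-1) powi (\<lfloor>p\<rfloor> + 1) * (X p \<bullet> e1)\<^sup>2 * (X p \<bullet> e2))"

end

theory Submission imports Defs begin

text \<open>
  Write \<open>X\<close> and \<open>Y\<close> for the old and the new curve. Testing the first equation with \<open>\<kappa>\<close> and the
  second with \<open>Y - X\<close>, which is an admissible test function, makes the term
  \<open>\<langle>Y - X, \<kappa> f\<rangle>\<close> common to both; eliminating it expresses the dissipation
  \<open>\<Delta>t \<langle>(X \<bullet> e1) \<kappa>\<^sub>\<rho>, \<kappa>\<^sub>\<rho> |X\<^sub>\<rho>|\<^sup>-\<^sup>1\<rangle>\<close> as minus the sum of the two remaining inner products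
  of the second equation. These bound the increase of the area integral of
  \<open>(X \<bullet> e1) |X\<^sub>\<rho>|\<close> from above (\<open>surface_area_change_le\<close>), by the pointwise inequality
  \<open>norm_diff_le_inner\<close> and the nonnegativity of \<open>X \<bullet> e1\<close>.

  For the volume, \<open>f\<close> is designed such that \<open>2 \<pi> \<langle>Y - X, f\<rangle>\<close> is exactly the volume difference:
  pointwise the two volume densities differ by \<open>2 (Y - X) \<bullet> f\<close> minus the derivative of an
  explicit flux (\<open>volume_flux_has_derivative\<close>), whose end point values match the cap
  terms under every boundary condition (\<open>volume_flux_boundary\<close>). The constant test function in
  the first equation then shows that the difference vanishes.

  All identities are pointwise away from the nodes, where derivatives exist. The integrands
  agree inside each element with a function continuous on the closed element, which gives
  integrability, and the finitely many nodes are negligible.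
\<close>

section \<open>Elementwise calculus on the grid\<close>

definition nodes :: "nat \<Rightarrow> real set" where
  "nodes J = node J ` {0..J}"

text \<open>
  The integrands of the scheme contain derivatives and hence have unspecified values at the
  nodes; this is why only the interiors of the elements are constrained.
\<close>

definition elementwise_continuous :: "nat \<Rightarrow> (real \<Rightarrow> 'a::topological_space) \<Rightarrow> bool" where
  "elementwise_continuous J f \<longleftrightarrow>
     (\<forall>j\<in>{1..J}. \<exists>g. continuous_on (element J j) g \<and> (\<forall>\<rho>\<in>interior (element J j). f \<rho> = g \<rho>))"

definition elementwise_constant :: "nat \<Rightarrow> (real \<Rightarrow> 'a) \<Rightarrow> bool" where
  "elementwise_constant J f \<longleftrightarrow> (\<forall>j\<in>{1..J}. \<exists>c. \<forall>\<rho>\<in>interior (element J j). f \<rho> = c)"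

definition elementwise_affine :: "nat \<Rightarrow> (real \<Rightarrow> 'a::real_vector) \<Rightarrow> bool" where
  "elementwise_affine J f \<longleftrightarrow> (\<forall>j\<in>{1..J}. \<exists>a b. \<forall>\<rho>\<in>element J j. f \<rho> = a + \<rho> *\<^sub>R b)"

lemma finite_nodes: "finite (nodes J)"
  by (simp add: nodes_def)

lemma node_mono: "i \<le> j \<Longrightarrow> node J i \<le> node J j"
  by (simp add: node_def divide_right_mono)

lemma node_bounds: "j \<le> J \<Longrightarrow> 0 \<le> node J j \<and> node J j \<le> 1"
  by (simp add: node_def divide_le_eq)

lemma element_subset: "j \<in> {1..J} \<Longrightarrow> element J j \<subseteq> {0..1}"
  using node_bounds[of j J] node_bounds[of "j - 1" J] by (auto simp: element_def)

lemma interior_element: "interior (element J j) = {node J (j - 1)<..<node J j}"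
  by (simp add: element_def interior_atLeastAtMost_real)

lemma off_nodes_in_element:
  assumes "J \<ge> 1" "\<rho> \<in> {0..1} - nodes J"
  obtains j where "j \<in> {1..J}" "\<rho> \<in> interior (element J j)"
proof -
  define j where "j = nat \<lceil>\<rho> * real J\<rceil>"
  have J: "real J > 0" using assms by simp
  have "node J 0 \<in> nodes J" by (simp add: nodes_def)
  then have "\<rho> \<noteq> 0" using assms by (auto simp: node_def)
  then have pos: "\<rho> > 0" using assms by auto
  have "\<rho> * real J > 0" using pos J by simp
  moreover have "\<rho> * real J \<le> real J" using assms J by (simp add: mult_left_le_one_le)
  ultimately have j: "1 \<le> j" "j \<le> J" unfolding j_def by linarith+
  have "real j - 1 < \<rho> * real J" "\<rho> * real J \<le> real j"
    using \<open>\<rho> * real J > 0\<close> unfolding j_def by linarith+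
  then have "node J (j - 1) < \<rho>" "\<rho> \<le> node J j"
    using J j by (simp_all add: node_def field_simps of_nat_diff)
  moreover have "\<rho> \<noteq> node J j" using assms j by (auto simp: nodes_def)
  ultimately show ?thesis using that[of j] j by (auto simp: interior_element)
qed

lemma elementwise_constant_imp_continuous:
  "elementwise_constant J f \<Longrightarrow> elementwise_continuous J f"
  unfolding elementwise_constant_def elementwise_continuous_def
  by (metis continuous_on_const)

lemma elementwise_constant_compose:
  "elementwise_constant J f \<Longrightarrow> elementwise_constant J (\<lambda>\<rho>. h (f \<rho>))"
  unfolding elementwise_constant_def by metis

lemma continuous_imp_elementwise_continuous:
  assumes "continuous_on {0..1} f"
  shows "elementwise_continuous J f"
  unfolding elementwise_continuous_def
  using continuous_on_subset[OF assms element_subset] by blast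

lemma elementwise_continuous_const: "elementwise_continuous J (\<lambda>\<rho>. c)"
  by (simp add: continuous_imp_elementwise_continuous)

lemma elementwise_continuous_combine:
  assumes "elementwise_continuous J f" "elementwise_continuous J g"
    and "\<And>S u v. continuous_on (S::real set) u \<Longrightarrow> continuous_on S v \<Longrightarrow>
           continuous_on S (\<lambda>\<rho>. h (u \<rho>) (v \<rho>))"
  shows "elementwise_continuous J (\<lambda>\<rho>. h (f \<rho>) (g \<rho>))"
  unfolding elementwise_continuous_def
proof
  fix j assume j: "j \<in> {1..J}"
  obtain u where u: "continuous_on (element J j) u" "\<forall>\<rho>\<in>interior (element J j). f \<rho> = u \<rho>"
    using assms(1) j unfolding elementwise_continuous_def by blast
  obtain v where v: "continuous_on (element J j) v" "\<forall>\<rho>\<in>interior (element J j). g \<rho> = v \<rho>"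
    using assms(2) j unfolding elementwise_continuous_def by blast
  show "\<exists>w. continuous_on (element J j) w \<and> (\<forall>\<rho>\<in>interior (element J j). h (f \<rho>) (g \<rho>) = w \<rho>)"
    using assms(3)[OF u(1) v(1)] u(2) v(2) by (intro exI[of _ "\<lambda>\<rho>. h (u \<rho>) (v \<rho>)"]) simp
qed

lemma elementwise_continuous_add:
  fixes f :: "real \<Rightarrow> 'a::real_normed_vector"
  shows "elementwise_continuous J f \<Longrightarrow> elementwise_continuous J g \<Longrightarrow>
         elementwise_continuous J (\<lambda>\<rho>. f \<rho> + g \<rho>)"
  by (rule elementwise_continuous_combine) (simp_all add: continuous_on_add)

lemma elementwise_continuous_diff:
  fixes f :: "real \<Rightarrow> 'a::real_normed_vector"
  shows "elementwise_continuous J f \<Longrightarrow> elementwise_continuous J g \<Longrightarrow>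
         elementwise_continuous J (\<lambda>\<rho>. f \<rho> - g \<rho>)"
  by (rule elementwise_continuous_combine) (simp_all add: continuous_on_diff)

lemma elementwise_continuous_mult:
  fixes f :: "real \<Rightarrow> real"
  shows "elementwise_continuous J f \<Longrightarrow> elementwise_continuous J g \<Longrightarrow>
         elementwise_continuous J (\<lambda>\<rho>. f \<rho> * g \<rho>)"
  by (rule elementwise_continuous_combine) (simp_all add: continuous_on_mult)

lemma elementwise_continuous_inner:
  fixes f :: "real \<Rightarrow> 'a::real_inner"
  shows "elementwise_continuous J f \<Longrightarrow> elementwise_continuous J g \<Longrightarrow>
         elementwise_continuous J (\<lambda>\<rho>. f \<rho> \<bullet> g \<rho>)"
  by (rule elementwise_continuous_combine) (simp_all add: continuous_on_inner)

lemma elementwise_continuous_power: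
  fixes f :: "real \<Rightarrow> real"
  shows "elementwise_continuous J f \<Longrightarrow> elementwise_continuous J (\<lambda>\<rho>. f \<rho> ^ n)"
  by (induction n) (auto intro: elementwise_continuous_const elementwise_continuous_mult)

lemmas elementwise_intros =
  elementwise_continuous_const elementwise_continuous_add elementwise_continuous_diff
  elementwise_continuous_mult elementwise_continuous_inner elementwise_continuous_power

lemma elementwise_continuous_integrable:
  fixes f :: "real \<Rightarrow> real"
  assumes "J \<ge> 1" "elementwise_continuous J f"
  shows "f integrable_on {0..1}"
proof -
  have elem: "f integrable_on {node J k .. node J (Suc k)}" if k: "Suc k \<le> J" for k
  proof -
    have "Suc k \<in> {1..J}" using k by simp
    then obtain g where g: "continuous_on (element J (Suc k)) g"
      "\<forall>\<rho>\<in>interior (element J (Suc k)). f \<rho> = g \<rho>"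
      using assms(2) unfolding elementwise_continuous_def by blast
    have int: "g integrable_on {node J k .. node J (Suc k)}"
      using g(1) by (intro integrable_continuous_real) (simp add: element_def)
    show ?thesis
    proof (rule integrable_spike_finite[OF _ _ int])
      show "finite {node J k, node J (Suc k)}" by simp
      show "f x = g x" if "x \<in> {node J k .. node J (Suc k)} - {node J k, node J (Suc k)}" for x
        using g(2) that by (auto simp: interior_element)
    qed
  qed
  have "f integrable_on {0 .. node J k}" if "k \<le> J" for k
    using that
  proof (induction k)
    case 0
    have "f integrable_on cbox 0 0" by (rule integrable_on_refl)
    then show ?case by (simp add: node_def)
  next
    case (Suc k)
    from Suc.prems show ?case
      using node_bounds[of k J] node_mono[of k "Suc k" J]
      by (intro Henstock_Kurzweil_Integration.integrable_combine[OF _ _ Suc.IH elem[of k]]) auto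
  qed
  from this[of J] show ?thesis using assms by (simp add: node_def)
qed

lemma integral_mono_off_nodes:
  fixes f g :: "real \<Rightarrow> real"
  assumes "f integrable_on {0..1}" "g integrable_on {0..1}"
    and "\<And>\<rho>. \<rho> \<in> {0..1} - nodes J \<Longrightarrow> f \<rho> \<le> g \<rho>"
  shows "integral {0..1} f \<le> integral {0..1} g"
proof -
  define f' where "f' \<rho> = (if \<rho> \<in> nodes J then g \<rho> else f \<rho>)" for \<rho>
  have "f' integrable_on {0..1}"
    using assms(1)
    by (rule integrable_spike_finite[OF finite_nodes[of J], rotated]) (auto simp: f'_def)
  moreover have "integral {0..1} f = integral {0..1} f'"
    by (rule integral_spike[OF negligible_finite[OF finite_nodes[of J]]]) (simp add: f'_def)
  ultimately show ?thesis
    using assms(2,3) by (auto simp: f'_def intro: integral_le)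
qed

lemma integral_cong_off_nodes:
  fixes f g :: "real \<Rightarrow> real"
  assumes "\<And>\<rho>. \<rho> \<in> {0..1} - nodes J \<Longrightarrow> f \<rho> = g \<rho>"
  shows "integral {0..1} f = integral {0..1} g"
  using assms
  by (intro integral_spike[OF negligible_finite[OF finite_nodes[of J]]]) auto

section \<open>Finite element functions\<close>

lemma elementwise_affine_derivative:
  fixes f :: "real \<Rightarrow> 'a::real_normed_vector"
  assumes "\<forall>\<rho>\<in>element J j. f \<rho> = a + \<rho> *\<^sub>R b" "\<rho> \<in> interior (element J j)"
  shows "(f has_vector_derivative b) (at \<rho>)"
proof (rule has_vector_derivative_transform_within_open)
  show "((\<lambda>\<rho>. a + \<rho> *\<^sub>R b) has_vector_derivative b) (at \<rho>)"
    by (auto intro!: derivative_eq_intros)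
  show "\<And>x. x \<in> interior (element J j) \<Longrightarrow> a + x *\<^sub>R b = f x"
    using assms(1) interior_subset by (metis subsetD)
qed (use assms in auto)

lemma elementwise_affine_d_constant:
  fixes f :: "real \<Rightarrow> 'a::real_normed_vector"
  assumes "elementwise_affine J f"
  shows "elementwise_constant J (\<lambda>\<rho>. d\<rho> f \<rho>)"
  using assms unfolding elementwise_affine_def elementwise_constant_def
  by (meson elementwise_affine_derivative vector_derivative_at)

lemma elementwise_affine_has_derivative:
  fixes f :: "real \<Rightarrow> 'a::real_normed_vector"
  assumes "J \<ge> 1" "elementwise_affine J f" "\<rho> \<in> {0..1} - nodes J"
  shows "(f has_vector_derivative d\<rho> f \<rho>) (at \<rho>)"
  using off_nodes_in_element[OF assms(1,3)] assms(2) unfolding elementwise_affine_def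
  by (metis elementwise_affine_derivative vector_derivative_at)

lemma Vh_const: "(\<lambda>\<rho>. c) \<in> Vh I J"
  unfolding Vh_def by simp (metis add.right_neutral mult_zero_left)

lemma Vh_continuous: "\<phi> \<in> Vh I J \<Longrightarrow> continuous_on {0..1} \<phi>"
  unfolding Vh_def by simp

lemma Vh_add:
  assumes "\<phi> \<in> Vh I J" "\<psi> \<in> Vh I J"
  shows "(\<lambda>\<rho>. \<phi> \<rho> + \<psi> \<rho>) \<in> Vh I J"
proof -
  have "\<exists>a b. \<forall>\<rho>\<in>element J j. \<phi> \<rho> + \<psi> \<rho> = a + b * \<rho>" if j: "j \<in> {1..J}" for j
  proof -
    obtain a b where "\<forall>\<rho>\<in>element J j. \<phi> \<rho> = a + b * \<rho>"
      using assms(1) j unfolding Vh_def by blast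
    moreover obtain c d where "\<forall>\<rho>\<in>element J j. \<psi> \<rho> = c + d * \<rho>"
      using assms(2) j unfolding Vh_def by blast
    ultimately show ?thesis
      by (intro exI[of _ "a + c"] exI[of _ "b + d"]) (auto simp: algebra_simps)
  qed
  then show ?thesis using assms unfolding Vh_def by (auto intro: continuous_on_add)
qed

lemma Vh_vec_component: "X \<in> Vh_vec I J \<Longrightarrow> (\<lambda>\<rho>. X \<rho> $ i) \<in> Vh I J"
  unfolding Vh_vec_def by simp

lemma Vh_vec_continuous: "X \<in> Vh_vec I J \<Longrightarrow> continuous_on {0..1} X"
  using continuous_on_vec_lambda[of "{0..1}" "\<lambda>i \<rho>. X \<rho> $ i"]
  by (simp add: Vh_continuous[OF Vh_vec_component])

lemma Vh_vec_elementwise_affine: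
  assumes "X \<in> Vh_vec I J"
  shows "elementwise_affine J X"
  unfolding elementwise_affine_def
proof
  fix j assume "j \<in> {1..J}"
  then have "\<forall>i. \<exists>a b. \<forall>\<rho>\<in>element J j. X \<rho> $ i = a + b * \<rho>"
    using assms unfolding Vh_vec_def Vh_def by blast
  then obtain a b where "\<forall>i. \<forall>\<rho>\<in>element J j. X \<rho> $ i = a i + b i * \<rho>" by metis
  then show "\<exists>a b. \<forall>\<rho>\<in>element J j. X \<rho> = a + \<rho> *\<^sub>R b"
    by (intro exI[of _ "\<chi> i. a i"] exI[of _ "\<chi> i. b i"]) (simp add: vec_eq_iff mult.commute)
qed

lemma Vh_vec_shift:
  assumes "X \<in> Vh_d0 I J B0" "(\<lambda>\<rho>. Y \<rho> - X \<rho>) \<in> Vh_d I J BD B0 B1 B2"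
  shows "Y \<in> Vh_vec I J"
proof -
  have "X \<in> Vh_vec I J" "(\<lambda>\<rho>. Y \<rho> - X \<rho>) \<in> Vh_vec I J"
    using assms by (simp_all add: Vh_d_def Vh_d0_def)
  then have "(\<lambda>\<rho>. X \<rho> $ i + (Y \<rho> - X \<rho>) $ i) \<in> Vh I J" for i
    by (intro Vh_add Vh_vec_component)
  then show ?thesis unfolding Vh_vec_def by simp
qed

lemma Vh_vec_elementwise_continuous:
  "X \<in> Vh_vec I J \<Longrightarrow> elementwise_continuous J X"
  by (intro continuous_imp_elementwise_continuous Vh_vec_continuous)

lemma Vh_vec_d_continuous:
  "X \<in> Vh_vec I J \<Longrightarrow> elementwise_continuous J (\<lambda>\<rho>. h (d\<rho> X \<rho>))"
  by (intro elementwise_constant_imp_continuous elementwise_constant_compose[where h = h]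
        elementwise_affine_d_constant Vh_vec_elementwise_affine)

lemma d_diff_off_nodes:
  assumes "J \<ge> 1" "X \<in> Vh_vec I J" "Y \<in> Vh_vec I J" "\<rho> \<in> {0..1} - nodes J"
  shows "d\<rho> (\<lambda>\<rho>. Y \<rho> - X \<rho>) \<rho> = d\<rho> Y \<rho> - d\<rho> X \<rho>"
  using assms
  by (intro vector_derivative_at has_vector_derivative_diff elementwise_affine_has_derivative)
     (auto intro: Vh_vec_elementwise_affine)

lemma inner_e: "v \<bullet> e1 = v $ 1" "v \<bullet> e2 = v $ 2" for v :: "real ^ 2"
  by (simp_all add: inner_axis)

lemma inner_real2: "v \<bullet> w = v $ 1 * w $ 1 + v $ 2 * w $ 2" for v w :: "real ^ 2"
  by (simp add: inner_vec_def sum_2)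

lemma perp_component: "perp v $ 1 = v $ 2" "perp v $ 2 = - (v $ 1)"
  by (simp_all add: perp_def)

lemma admissible_nonneg:
  assumes "X \<in> Vh_d0 I J B0" "admissible_curve J B0 X" "\<rho> \<in> {0..1}"
  shows "X \<rho> \<bullet> e1 \<ge> 0"
proof (cases "\<rho> \<in> B0")
  case True
  then show ?thesis using assms(1) by (simp add: Vh_d0_def)
next
  case False
  then have "X \<rho> \<bullet> e1 > 0" using assms(2,3) unfolding admissible_curve_def by blast
  then show ?thesis by simp
qed

lemma admissible_d_nonzero:
  assumes "J \<ge> 1" "admissible_curve J B0 X" "\<rho> \<in> {0..1} - nodes J"
  shows "d\<rho> X \<rho> \<noteq> 0"
  using off_nodes_in_element[OF assms(1,3)] assms(2) unfolding admissible_curve_def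
  by (metis norm_zero less_irrefl)

section \<open>Surface area\<close>

text \<open>
  By Cauchy--Schwarz the right-hand side is at least \<open>|a|(|a| - |b|)/|b|\<close>, which exceeds
  \<open>|a| - |b|\<close> by \<open>(|a| - |b|)\<^sup>2/|b|\<close>. This is what makes the semi-implicit treatment
  of the length element, with the old \<open>|X\<^sub>\<rho>|\<close> in the denominator, stable.
\<close>

lemma norm_diff_le_inner:
  fixes a b :: "'a::real_inner"
  assumes "b \<noteq> 0"
  shows "norm a - norm b \<le> a \<bullet> (inverse (norm b) *\<^sub>R (a - b))"
proof -
  have b: "norm b > 0" using assms by simp
  have "(norm a - norm b) * norm b \<le> norm a * norm a - norm a * norm b"
    using zero_le_power2[of "norm a - norm b"] by (simp add: power2_eq_square algebra_simps)
  also have "\<dots> \<le> a \<bullet> (a - b)"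
    using norm_cauchy_schwarz[of a b]
    by (simp add: inner_diff_right power2_norm_eq_inner[symmetric] power2_eq_square)
  finally have "norm a - norm b \<le> (a \<bullet> (a - b)) / norm b"
    using b by (simp only: pos_le_divide_eq)
  then show ?thesis
    by (simp only: inner_scaleR_right divide_inverse mult.commute)
qed

text \<open>
  The product \<open>(X \<bullet> e1) |X\<^sub>\<rho>|\<close> changes by
  \<open>((Y - X) \<bullet> e1) |Y\<^sub>\<rho>| + (X \<bullet> e1) (|Y\<^sub>\<rho>| - |X\<^sub>\<rho>|)\<close>. The nonnegative weight \<open>X \<bullet> e1\<close>
  allows the second summand to be estimated pointwise by the lemma above. The two resulting
  inner products are those of the curvature equation with test function \<open>Y - X\<close>.
\<close>

lemma surface_area_change_le:
  assumes J: "J \<ge> 1" and X: "X \<in> Vh_vec I J" and Y: "Y \<in> Vh_vec I J"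
    and nonneg: "\<And>\<rho>. \<rho> \<in> {0..1} \<Longrightarrow> X \<rho> \<bullet> e1 \<ge> 0"
    and nonzero: "\<And>\<rho>. \<rho> \<in> {0..1} - nodes J \<Longrightarrow> d\<rho> X \<rho> \<noteq> 0"
  shows "surface_area Y - surface_area X \<le> 2 * pi *
     (l2_inner (\<lambda>\<rho>. (Y \<rho> - X \<rho>) \<bullet> e1) (\<lambda>\<rho>. norm (d\<rho> Y \<rho>))
      + l2_inner (\<lambda>\<rho>. (X \<rho> \<bullet> e1) *\<^sub>R d\<rho> Y \<rho>)
          (\<lambda>\<rho>. inverse (norm (d\<rho> X \<rho>)) *\<^sub>R d\<rho> (\<lambda>\<rho>. Y \<rho> - X \<rho>) \<rho>))"
proof -
  note cX = Vh_vec_elementwise_continuous[OF X] Vh_vec_d_continuous[OF X]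
  note cY = Vh_vec_elementwise_continuous[OF Y] Vh_vec_d_continuous[OF Y]
  let ?AX = "\<lambda>\<rho>. (X \<rho> \<bullet> e1) * norm (d\<rho> X \<rho>)"
  let ?AY = "\<lambda>\<rho>. (Y \<rho> \<bullet> e1) * norm (d\<rho> Y \<rho>)"
  let ?P = "\<lambda>\<rho>. ((Y \<rho> - X \<rho>) \<bullet> e1) * norm (d\<rho> Y \<rho>)"
  let ?Q = "\<lambda>\<rho>. (X \<rho> \<bullet> e1) * (inverse (norm (d\<rho> X \<rho>)) * (d\<rho> Y \<rho> \<bullet> (d\<rho> Y \<rho> - d\<rho> X \<rho>)))"
  have int: "?AX integrable_on {0..1}" "?AY integrable_on {0..1}" "?P integrable_on {0..1}"
    "?Q integrable_on {0..1}"
    by (intro elementwise_continuous_integrable[OF J] elementwise_intros cX cY)+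
  have "integral {0..1} ?AY - integral {0..1} ?AX = integral {0..1} (\<lambda>\<rho>. ?AY \<rho> - ?AX \<rho>)"
    using int by (simp add: Henstock_Kurzweil_Integration.integral_diff)
  also have "\<dots> \<le> integral {0..1} (\<lambda>\<rho>. ?P \<rho> + ?Q \<rho>)"
  proof (rule integral_mono_off_nodes)
    fix \<rho> assume \<rho>: "\<rho> \<in> {0..1} - nodes J"
    have "(X \<rho> \<bullet> e1) * (norm (d\<rho> Y \<rho>) - norm (d\<rho> X \<rho>)) \<le> ?Q \<rho>"
      using norm_diff_le_inner[OF nonzero[OF \<rho>], of "d\<rho> Y \<rho>"] nonneg \<rho>
      by (intro mult_left_mono) auto
    then show "?AY \<rho> - ?AX \<rho> \<le> ?P \<rho> + ?Q \<rho>"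
      by (simp add: inner_diff_left algebra_simps)
  qed (use int in \<open>auto intro: Henstock_Kurzweil_Integration.integrable_diff Henstock_Kurzweil_Integration.integrable_add\<close>)
  also have "\<dots> = integral {0..1} ?P + integral {0..1} ?Q"
    using int by (simp add: Henstock_Kurzweil_Integration.integral_add)
  also have "integral {0..1} ?Q = l2_inner (\<lambda>\<rho>. (X \<rho> \<bullet> e1) *\<^sub>R d\<rho> Y \<rho>)
          (\<lambda>\<rho>. inverse (norm (d\<rho> X \<rho>)) *\<^sub>R d\<rho> (\<lambda>\<rho>. Y \<rho> - X \<rho>) \<rho>)"
    unfolding l2_inner_def
    by (rule integral_cong_off_nodes[of J]) (simp add: d_diff_off_nodes[OF J X Y] mult_ac)
  finally have "integral {0..1} ?AY - integral {0..1} ?AX \<le>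
      l2_inner (\<lambda>\<rho>. (Y \<rho> - X \<rho>) \<bullet> e1) (\<lambda>\<rho>. norm (d\<rho> Y \<rho>))
      + l2_inner (\<lambda>\<rho>. (X \<rho> \<bullet> e1) *\<^sub>R d\<rho> Y \<rho>)
          (\<lambda>\<rho>. inverse (norm (d\<rho> X \<rho>)) *\<^sub>R d\<rho> (\<lambda>\<rho>. Y \<rho> - X \<rho>) \<rho>)"
    by (simp add: l2_inner_def)
  then have "2 * pi * (integral {0..1} ?AY - integral {0..1} ?AX) \<le> 2 * pi * (
      l2_inner (\<lambda>\<rho>. (Y \<rho> - X \<rho>) \<bullet> e1) (\<lambda>\<rho>. norm (d\<rho> Y \<rho>))
      + l2_inner (\<lambda>\<rho>. (X \<rho> \<bullet> e1) *\<^sub>R d\<rho> Y \<rho>)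
          (\<lambda>\<rho>. inverse (norm (d\<rho> X \<rho>)) *\<^sub>R d\<rho> (\<lambda>\<rho>. Y \<rho> - X \<rho>) \<rho>))"
    by (intro mult_left_mono) auto
  then show ?thesis by (simp add: surface_area_def right_diff_distrib)
qed

section \<open>Enclosed volume\<close>

text \<open>
  In coordinates the volume density \<open>((X \<bullet> e1)\<^sup>2 \<nu> \<bullet> e1) |X\<^sub>\<rho>|\<close> is \<open>- x\<^sub>1\<^sup>2 x\<^sub>2'\<close>. Along the
  segment \<open>Z = X + t (Y - X)\<close> its rate of change is
  \<open>2 (Y - X) \<bullet> (- (z\<^sub>1 Z\<^sub>\<rho>)\<^sup>\<bottom>)\<close> minus the \<open>\<rho>\<close>-derivative of \<open>z\<^sub>1\<^sup>2 (y\<^sub>2 - x\<^sub>2)\<close>. The average over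
  \<open>t \<in> [0,1]\<close> of the weighted normal \<open>- (z\<^sub>1 Z\<^sub>\<rho>)\<^sup>\<bottom>\<close> is \<open>f\<close>, and that of \<open>z\<^sub>1\<^sup>2 (y\<^sub>2 - x\<^sub>2)\<close> is
  the flux.
\<close>

definition volume_flux :: "(real \<Rightarrow> real ^ 2) \<Rightarrow> (real \<Rightarrow> real ^ 2) \<Rightarrow> real \<Rightarrow> real" where
  "volume_flux X Y \<rho> =
     (Y \<rho> $ 2 - X \<rho> $ 2) * ((X \<rho> $ 1)\<^sup>2 + X \<rho> $ 1 * Y \<rho> $ 1 + (Y \<rho> $ 1)\<^sup>2) / 3"

lemma volume_flux_has_derivative:
  assumes "(X has_vector_derivative X') (at \<rho>)" "(Y has_vector_derivative Y') (at \<rho>)"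
  shows "(volume_flux X Y has_vector_derivative
     (2 * ((Y \<rho> - X \<rho>) \<bullet> avg_weighted_normal X Y \<rho>)
      + (Y \<rho> $ 1)\<^sup>2 * Y' $ 2 - (X \<rho> $ 1)\<^sup>2 * X' $ 2)) (at \<rho>)"
proof -
  have x: "((\<lambda>\<rho>. X \<rho> $ i) has_real_derivative X' $ i) (at \<rho>)" for i
    using bounded_linear.has_vector_derivative[OF bounded_linear_vec_nth assms(1)]
    by (simp add: has_real_derivative_iff_has_vector_derivative)
  have y: "((\<lambda>\<rho>. Y \<rho> $ i) has_real_derivative Y' $ i) (at \<rho>)" for i
    using bounded_linear.has_vector_derivative[OF bounded_linear_vec_nth assms(2)]
    by (simp add: has_real_derivative_iff_has_vector_derivative)
  let ?G' = "((Y' $ 2 - X' $ 2) * ((X \<rho> $ 1)\<^sup>2 + X \<rho> $ 1 * Y \<rho> $ 1 + (Y \<rho> $ 1)\<^sup>2)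
      + (Y \<rho> $ 2 - X \<rho> $ 2) * (2 * X \<rho> $ 1 * X' $ 1 + X' $ 1 * Y \<rho> $ 1 + X \<rho> $ 1 * Y' $ 1
         + 2 * Y \<rho> $ 1 * Y' $ 1)) / 3"
  have "(volume_flux X Y has_real_derivative ?G') (at \<rho>)"
    unfolding volume_flux_def
    by (rule derivative_eq_intros x y refl)+ (simp_all add: field_simps)
  moreover have "?G' = 2 * ((Y \<rho> - X \<rho>) \<bullet> avg_weighted_normal X Y \<rho>)
      + (Y \<rho> $ 1)\<^sup>2 * Y' $ 2 - (X \<rho> $ 1)\<^sup>2 * X' $ 2"
    unfolding avg_weighted_normal_def inner_e assms[THEN vector_derivative_at]
    unfolding inner_real2
    by (simp add: perp_component power2_eq_square field_simps)
  ultimately show ?thesis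
    by (simp add: has_real_derivative_iff_has_vector_derivative)
qed

text \<open>
  Every boundary condition either kills the flux or, on \<open>B1\<close>, where only the first coordinate
  is kept fixed, makes it equal to the change of \<open>x\<^sub>1\<^sup>2 x\<^sub>2\<close>, the cap term up to its sign. For a
  closed curve the two ends cancel by periodicity.
\<close>

lemma volume_flux_boundary:
  assumes part: "boundary_partition I BD B0 B1 B2"
    and X: "X \<in> Vh_d0 I J B0" and D: "(\<lambda>\<rho>. Y \<rho> - X \<rho>) \<in> Vh_d I J BD B0 B1 B2"
  shows "(\<Sum>p\<in>B1. (-1) powi (\<lfloor>p\<rfloor> + 1) * (Y p \<bullet> e1)\<^sup>2 * (Y p \<bullet> e2))
       - (\<Sum>p\<in>B1. (-1) powi (\<lfloor>p\<rfloor> + 1) * (X p \<bullet> e1)\<^sup>2 * (X p \<bullet> e2))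
       = volume_flux X Y 1 - volume_flux X Y 0"
proof (cases I)
  case Circle
  have per: "Z (0 + 1) $ i = Z 0 $ i" if "Z \<in> Vh_vec I J" for Z :: "real \<Rightarrow> real ^ 2" and i
    using Vh_vec_component[OF that, of i] Circle unfolding Vh_def by blast
  have X': "X \<in> Vh_vec I J" using X by (simp add: Vh_d0_def)
  moreover have "Y \<in> Vh_vec I J" by (rule Vh_vec_shift[OF X D])
  ultimately have "volume_flux X Y 1 = volume_flux X Y 0"
    using per[of X] per[of Y] by (simp add: volume_flux_def)
  moreover have "B1 = {}" using part Circle by (auto simp: boundary_partition_def)
  ultimately show ?thesis by simp
next
  case Unit_Interval
  have B: "{0, 1} = BD \<union> B0 \<union> B1 \<union> B2"
    using part Unit_Interval by (simp add: boundary_partition_def)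
  have cap: "(Y p \<bullet> e1)\<^sup>2 * (Y p \<bullet> e2) - (X p \<bullet> e1)\<^sup>2 * (X p \<bullet> e2) = volume_flux X Y p"
    if "p \<in> B1" for p
  proof -
    have "Y p $ 1 = X p $ 1" using D that by (auto simp: Vh_d_def inner_e)
    then show ?thesis by (simp add: volume_flux_def inner_e power2_eq_square field_simps)
  qed
  have zero: "volume_flux X Y p = 0" if p: "p \<in> {0, 1} - B1" for p
  proof -
    have "p \<in> BD \<or> p \<in> B0 \<or> p \<in> B2" using p B by blast
    then show ?thesis
    proof (elim disjE)
      assume "p \<in> BD"
      then have "Y p = X p" using D by (auto simp: Vh_d_def)
      then show ?thesis by (simp add: volume_flux_def)
    next
      assume p0: "p \<in> B0"
      then have "X p $ 1 = 0" using X by (auto simp: Vh_d0_def inner_e)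
      moreover have "Y p $ 1 = X p $ 1" using D p0 by (auto simp: Vh_d_def Vh_d0_def inner_e)
      ultimately show ?thesis by (simp add: volume_flux_def)
    next
      assume "p \<in> B2"
      then have "Y p $ 2 = X p $ 2" using D by (auto simp: Vh_d_def inner_e)
      then show ?thesis by (simp add: volume_flux_def)
    qed
  qed
  have "(\<Sum>p\<in>B1. (-1) powi (\<lfloor>p\<rfloor> + 1) * (Y p \<bullet> e1)\<^sup>2 * (Y p \<bullet> e2))
       - (\<Sum>p\<in>B1. (-1) powi (\<lfloor>p\<rfloor> + 1) * (X p \<bullet> e1)\<^sup>2 * (X p \<bullet> e2))
       = (\<Sum>p\<in>B1. (-1) powi (\<lfloor>p\<rfloor> + 1) * volume_flux X Y p)"
    unfolding sum_subtractf[symmetric]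
    by (intro sum.cong refl) (simp add: cap[symmetric] right_diff_distrib mult.assoc)
  also have "\<dots> = (\<Sum>p\<in>{0, 1}. (-1) powi (\<lfloor>p\<rfloor> + 1) * volume_flux X Y p)"
  proof (rule sum.mono_neutral_left)
    show "B1 \<subseteq> {0, 1}" using B by blast
  qed (simp_all add: zero)
  also have "\<dots> = volume_flux X Y 1 - volume_flux X Y 0"
    by simp
  finally show ?thesis .
qed

lemma volume_integrand:
  "((X \<rho> \<bullet> e1)\<^sup>2 *\<^sub>R unit_normal X \<rho>) \<bullet> (norm (d\<rho> X \<rho>) *\<^sub>R e1) = - ((X \<rho> $ 1)\<^sup>2 * d\<rho> X \<rho> $ 2)"
  by (cases "d\<rho> X \<rho> = 0") (simp_all add: unit_normal_def inner_e perp_component)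

text \<open>
  Since the flux is continuous across the nodes, integrating its elementwise derivative leaves
  only the two end points.
\<close>

lemma enclosed_volume_change:
  assumes part: "boundary_partition I BD B0 B1 B2" and J: "J \<ge> 1"
    and X: "X \<in> Vh_d0 I J B0" and D: "(\<lambda>\<rho>. Y \<rho> - X \<rho>) \<in> Vh_d I J BD B0 B1 B2"
  shows "enclosed_volume B1 Y - enclosed_volume B1 X
       = 2 * pi * l2_inner (\<lambda>\<rho>. Y \<rho> - X \<rho>) (avg_weighted_normal X Y)"
proof -
  have X': "X \<in> Vh_vec I J" using X by (simp add: Vh_d0_def)
  have Y': "Y \<in> Vh_vec I J" by (rule Vh_vec_shift[OF X D])
  note cX = Vh_vec_d_continuous[OF X'] Vh_vec_d_continuous[OF X', of "\<lambda>v. v $ i" for i]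
    continuous_imp_elementwise_continuous[OF Vh_continuous[OF Vh_vec_component[OF X']]]
  note cY = Vh_vec_d_continuous[OF Y'] Vh_vec_d_continuous[OF Y', of "\<lambda>v. v $ i" for i]
    continuous_imp_elementwise_continuous[OF Vh_continuous[OF Vh_vec_component[OF Y']]]
  let ?F = "\<lambda>\<rho>. (Y \<rho> - X \<rho>) \<bullet> avg_weighted_normal X Y \<rho>"
  let ?cap = "\<lambda>Z::real \<Rightarrow> real ^ 2. \<Sum>p\<in>B1. (-1) powi (\<lfloor>p\<rfloor> + 1) * (Z p \<bullet> e1)\<^sup>2 * (Z p \<bullet> e2)"
  let ?vX = "\<lambda>\<rho>. (X \<rho> $ 1)\<^sup>2 * d\<rho> X \<rho> $ 2"
  let ?vY = "\<lambda>\<rho>. (Y \<rho> $ 1)\<^sup>2 * d\<rho> Y \<rho> $ 2"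
  have int: "?vX integrable_on {0..1}" "?vY integrable_on {0..1}"
    by (intro elementwise_continuous_integrable[OF J] elementwise_intros cX cY)+
  have "continuous_on {0..1} (volume_flux X Y)"
    unfolding volume_flux_def
    by (intro continuous_intros Vh_continuous[OF Vh_vec_component[OF X']]
          Vh_continuous[OF Vh_vec_component[OF Y']]) auto
  moreover have "(volume_flux X Y has_vector_derivative (2 * ?F \<rho> + ?vY \<rho> - ?vX \<rho>)) (at \<rho>)"
    if "\<rho> \<in> {0<..<1} - nodes J" for \<rho>
    using that X' Y' J
    by (intro volume_flux_has_derivative elementwise_affine_has_derivative[of J])
       (auto intro: Vh_vec_elementwise_affine)
  ultimately have flux: "((\<lambda>\<rho>. 2 * ?F \<rho> + ?vY \<rho> - ?vX \<rho>) has_integral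
      volume_flux X Y 1 - volume_flux X Y 0) {0..1}"
    by (intro fundamental_theorem_of_calculus_interior_strong[OF finite_nodes[of J]]) auto
  have "((\<lambda>\<rho>. (2 * ?F \<rho> + ?vY \<rho> - ?vX \<rho>) - ?vY \<rho> + ?vX \<rho>) has_integral
      volume_flux X Y 1 - volume_flux X Y 0 - integral {0..1} ?vY + integral {0..1} ?vX) {0..1}"
    using int by (intro has_integral_add has_integral_diff flux integrable_integral)
  then have "integral {0..1} (\<lambda>\<rho>. 2 * ?F \<rho>) =
      volume_flux X Y 1 - volume_flux X Y 0 - integral {0..1} ?vY + integral {0..1} ?vX"
    by (intro integral_unique) simp
  then have "2 * l2_inner (\<lambda>\<rho>. Y \<rho> - X \<rho>) (avg_weighted_normal X Y) =
      volume_flux X Y 1 - volume_flux X Y 0 - integral {0..1} ?vY + integral {0..1} ?vX"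
    by (simp add: l2_inner_def)
  then have *: "2 * l2_inner (\<lambda>\<rho>. Y \<rho> - X \<rho>) (avg_weighted_normal X Y) =
      (?cap Y - integral {0..1} ?vY) - (?cap X - integral {0..1} ?vX)"
    using volume_flux_boundary[OF part X D] by linarith
  have volume: "enclosed_volume B1 Z =
      pi * (?cap Z - integral {0..1} (\<lambda>\<rho>. (Z \<rho> $ 1)\<^sup>2 * d\<rho> Z \<rho> $ 2))"
    for Z
    unfolding enclosed_volume_def l2_inner_def volume_integrand integral_neg
    by (simp add: right_diff_distrib)
  have "enclosed_volume B1 Y - enclosed_volume B1 X
      = pi * (2 * l2_inner (\<lambda>\<rho>. Y \<rho> - X \<rho>) (avg_weighted_normal X Y))"
    unfolding volume * by (simp only: right_diff_distrib)
  then show ?thesis by simp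
qed

section \<open>Stability and volume conservation\<close>

theorem theorem3p2:
  fixes I :: param_domain and BD B0 B1 B2 :: "real set" and J :: nat
    and \<Delta>t :: real and Xm Xn :: "real \<Rightarrow> real ^ 2" and \<kappa> :: "real \<Rightarrow> real"
  assumes "boundary_partition I BD B0 B1 B2"
    and "J \<ge> 3"
    and "\<Delta>t > 0"
    and "Xm \<in> Vh_d0 I J B0"
    and "(\<lambda>\<rho>. Xn \<rho> - Xm \<rho>) \<in> Vh_d I J BD B0 B1 B2"
    and "\<kappa> \<in> Vh I J"
    and "admissible_curve J B0 Xm"
    and "admissible_curve J B0 Xn"
    and "\<forall>\<phi>\<in>Vh I J.
       1 / \<Delta>t * l2_inner (\<lambda>\<rho>. Xn \<rho> - Xm \<rho>) (\<lambda>\<rho>. \<phi> \<rho> *\<^sub>R avg_weighted_normal Xm Xn \<rho>)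
       - l2_inner (\<lambda>\<rho>. (Xm \<rho> \<bullet> e1) * d\<rho> \<kappa> \<rho>) (\<lambda>\<rho>. d\<rho> \<phi> \<rho> * inverse (norm (d\<rho> Xm \<rho>))) = 0"
    and "\<forall>\<eta>\<in>Vh_d I J BD B0 B1 B2.
       l2_inner (\<lambda>\<rho>. \<kappa> \<rho> *\<^sub>R avg_weighted_normal Xm Xn \<rho>) \<eta>
       + l2_inner (\<lambda>\<rho>. \<eta> \<rho> \<bullet> e1) (\<lambda>\<rho>. norm (d\<rho> Xn \<rho>))
       + l2_inner (\<lambda>\<rho>. (Xm \<rho> \<bullet> e1) *\<^sub>R d\<rho> Xn \<rho>)
           (\<lambda>\<rho>. inverse (norm (d\<rho> Xm \<rho>)) *\<^sub>R d\<rho> \<eta> \<rho>) = 0"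
  shows "surface_area Xn
       + 2 * pi * \<Delta>t * l2_inner (\<lambda>\<rho>. (Xm \<rho> \<bullet> e1) * d\<rho> \<kappa> \<rho>)
           (\<lambda>\<rho>. d\<rho> \<kappa> \<rho> * inverse (norm (d\<rho> Xm \<rho>)))
       \<le> surface_area Xm
    \<and> enclosed_volume B1 Xn = enclosed_volume B1 Xm"
proof -
  have J: "J \<ge> 1" using assms(2) by simp
  have Xm: "Xm \<in> Vh_vec I J" using assms(4) by (simp add: Vh_d0_def)
  have Xn: "Xn \<in> Vh_vec I J" by (rule Vh_vec_shift[OF assms(4,5)])
  let ?D = "l2_inner (\<lambda>\<rho>. (Xm \<rho> \<bullet> e1) * d\<rho> \<kappa> \<rho>) (\<lambda>\<rho>. d\<rho> \<kappa> \<rho> * inverse (norm (d\<rho> Xm \<rho>)))"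
  let ?N = "l2_inner (\<lambda>\<rho>. Xn \<rho> - Xm \<rho>) (\<lambda>\<rho>. \<kappa> \<rho> *\<^sub>R avg_weighted_normal Xm Xn \<rho>)"
  let ?A = "l2_inner (\<lambda>\<rho>. (Xn \<rho> - Xm \<rho>) \<bullet> e1) (\<lambda>\<rho>. norm (d\<rho> Xn \<rho>))
      + l2_inner (\<lambda>\<rho>. (Xm \<rho> \<bullet> e1) *\<^sub>R d\<rho> Xn \<rho>)
          (\<lambda>\<rho>. inverse (norm (d\<rho> Xm \<rho>)) *\<^sub>R d\<rho> (\<lambda>\<rho>. Xn \<rho> - Xm \<rho>) \<rho>)"
  \<comment> \<open>first equation tested with the curvature\<close>
  have "1 / \<Delta>t * ?N - ?D = 0"
    using assms(6,9) by blast
  then have N: "?N = \<Delta>t * ?D"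
    using assms(3) by (simp add: field_simps)
  \<comment> \<open>second equation tested with the displacement\<close>
  have "l2_inner (\<lambda>\<rho>. \<kappa> \<rho> *\<^sub>R avg_weighted_normal Xm Xn \<rho>) (\<lambda>\<rho>. Xn \<rho> - Xm \<rho>) + ?A = 0"
    using bspec[OF assms(10,5)] by simp
  moreover have "l2_inner (\<lambda>\<rho>. \<kappa> \<rho> *\<^sub>R avg_weighted_normal Xm Xn \<rho>) (\<lambda>\<rho>. Xn \<rho> - Xm \<rho>) = ?N"
    by (simp add: l2_inner_def inner_commute)
  ultimately have A: "?A = - (\<Delta>t * ?D)" using N by linarith
  have "surface_area Xn - surface_area Xm \<le> 2 * pi * ?A"
    using admissible_nonneg[OF assms(4,7)] admissible_d_nonzero[OF J assms(7)]
    by (intro surface_area_change_le[OF J Xm Xn])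
  then have area: "surface_area Xn + 2 * pi * \<Delta>t * ?D \<le> surface_area Xm"
    unfolding A by (simp add: mult.assoc)
  \<comment> \<open>first equation tested with the constant 1, for which the diffusion term vanishes\<close>
  have "l2_inner (\<lambda>\<rho>. Xn \<rho> - Xm \<rho>) (avg_weighted_normal Xm Xn) = 0"
    using bspec[OF assms(9) Vh_const[of 1]] assms(3) by (simp add: l2_inner_def)
  then have "enclosed_volume B1 Xn = enclosed_volume B1 Xm"
    using enclosed_volume_change[OF assms(1) J assms(4,5)] by simp
  with area show ?thesis by blast
qed

end
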